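(* Let $X$ be a bounded geometry metric space. If $X$ has property A, then $X$ has property $ULA_\mu$.
   Context: A metric space $X$ has bounded geometry if for all $R>0$ there is $N_R\in\mathbb{N}$ with $|B(x;R)|\le N_R$ for all $x\in X$, where $B(x;R)=\{y\in X: d(x,y)\le R\}$. For $E\subseteq X$ and $R>0$: $N_R(E)=\{y\in X: d(y,E)\le R\}$ and $\partial_RE=N_R(E)\setminus E$. Property A: let $\mathrm{Prob}(X)\subseteq \ell^1(X)$ be the set of probability measures on $X$. $X$ has property A if for all $R,\epsilon>0$ there exist $S>0$ and a map $\xi:X\to \mathrm{Prob}(X)$, $x\mapsto\xi_x$, such that $\|\xi_x-\xi_y\|_1<\epsilon$ whenever $d(x,y)\le R$, and $\xi_x$ is supported in $B(x;S)$ for all $x\in X$. $ULA_\mu$: for all $R,\epsilon>0$ there exists $S>0$ such that for all probability measures $\mu$ on $X$ there exists a finite set $E\subseteq X$ with $\mathrm{diam}(E)\le S$ and $\mu(\partial_RE)<\epsilon\,\mu(E)$. *)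

theory Defs
  imports "HOL-Analysis.Analysis" "HOL-Probability.Probability_Mass_Function"
begin

text \<open>
  The space \<open>X\<close> is the universe of a type \<open>'a\<close> of class \<^class>\<open>metric_space\<close>, passed as
  \<open>TYPE('a)\<close>; \<open>Prob(X)\<close> is \<open>'a pmf\<close>, the nonnegative functions on \<open>X\<close> with sum 1.
  In bounded geometry every closed ball is finite, so \<open>X\<close> is countable and discrete and these
  are all the (Borel) probability measures on \<open>X\<close>.
\<close>

definition bounded_geometry :: "'a::metric_space itself \<Rightarrow> bool" where
  "bounded_geometry X \<longleftrightarrow>
     (\<forall>R>0. \<exists>N::nat. \<forall>x::'a. finite (cball x R) \<and> card (cball x R) \<le> N)"

text \<open>
  The library sets \<open>infdist y {} = 0\<close>; the guard restores the convention \<open>d(y, {}) = \<infinity>\<close>.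
\<close>

definition nbhd :: "real \<Rightarrow> 'a::metric_space set \<Rightarrow> 'a set" where
  "nbhd R E = {y. E \<noteq> {} \<and> infdist y E \<le> R}"

definition bdry :: "real \<Rightarrow> 'a::metric_space set \<Rightarrow> 'a set" where
  "bdry R E = nbhd R E - E"

definition l1_dist :: "'a pmf \<Rightarrow> 'a pmf \<Rightarrow> real" where
  "l1_dist p q = (\<Sum>\<^sub>\<infinity>z. \<bar>pmf p z - pmf q z\<bar>)"

text \<open>The family below is always summable, so \<^const>\<open>infsum\<close> never takes its default value 0.\<close>

lemma l1_dist_summable: "(\<lambda>z. \<bar>pmf p z - pmf q z\<bar>) summable_on UNIV"
proof -
  have s: "pmf r summable_on UNIV" for r :: "'a pmf"
    using pmf_abs_summable[of r UNIV]
    by (simp only: abs_summable_equivalent[symmetric] summable_on_iff_abs_summable_on_real[symmetric])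
  have "(\<lambda>z. pmf p z - pmf q z) summable_on UNIV"
    using summable_on_add[OF s[of p] iffD2[OF summable_on_uminus s[of q]]] by simp
  from iffD1[OF summable_on_iff_abs_summable_on_real this] show ?thesis
    by (simp only: real_norm_def)
qed

definition property_A :: "'a::metric_space itself \<Rightarrow> bool" where
  "property_A X \<longleftrightarrow>
     (\<forall>R>0. \<forall>\<epsilon>>0. \<exists>S>0. \<exists>\<xi> :: 'a \<Rightarrow> 'a pmf.
        (\<forall>x y. dist x y \<le> R \<longrightarrow> l1_dist (\<xi> x) (\<xi> y) < \<epsilon>) \<and>
        (\<forall>x. set_pmf (\<xi> x) \<subseteq> cball x S))"

definition ULA_mu :: "'a::metric_space itself \<Rightarrow> bool" where
  "ULA_mu X \<longleftrightarrow>
     (\<forall>R>0. \<forall>\<epsilon>>0. \<exists>S>0. \<forall>\<mu> :: 'a pmf. \<exists>E.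
        finite E \<and> diameter E \<le> S \<and>
        measure_pmf.prob \<mu> (bdry R E) < \<epsilon> * measure_pmf.prob \<mu> E)"

end

theory Submission
  imports Defs
begin

text \<open>
  Slice the functions \<open>x \<mapsto> \<xi>\<^sub>x(z)\<close> into superlevel sets \<open>E(z,t) = {x. \<xi>\<^sub>x(z) > t}\<close>, which lie in
  the balls \<open>B(z;S)\<close>. Integrating \<open>\<mu>(E(z,t))\<close> over \<open>t \<ge> 0\<close> and summing over \<open>z\<close> gives 1, because
  each \<open>\<xi>\<^sub>x\<close> has mass 1. A point \<open>x\<close> is in the \<open>R\<close>-boundary of \<open>E(z,t)\<close> only if
  \<open>\<xi>\<^sub>x(z) \<le> t < \<xi>\<^sub>y(z)\<close> for some \<open>y \<in> B(x;R)\<close>, so the same integral of the boundary measures is at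
  most the \<open>\<mu>\<close>-average of \<open>\<Sum>\<^bsub>y \<in> B(x;R)\<^esub> \<parallel>\<xi>\<^sub>y - \<xi>\<^sub>x\<parallel>\<^sub>1\<close>. If this is less than \<open>\<epsilon>\<close>, some slice
  \<open>E(z,t)\<close> satisfies the required inequality.
\<close>

lemma emeasure_between_conv_nn_integral:
  fixes f g :: "'a \<Rightarrow> real"
  assumes [measurable]: "f \<in> borel_measurable M" "g \<in> borel_measurable M"
  shows "emeasure M {x \<in> space M. f x \<le> t \<and> t < g x} = (\<integral>\<^sup>+x. indicator {f x..<g x} t \<partial>M)"
proof -
  have "emeasure M {x \<in> space M. f x \<le> t \<and> t < g x}
      = (\<integral>\<^sup>+x. indicator {x \<in> space M. f x \<le> t \<and> t < g x} x \<partial>M)"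
    by (rule nn_integral_indicator[symmetric]) measurable
  also have "\<dots> = (\<integral>\<^sup>+x. indicator {f x..<g x} t \<partial>M)"
    by (rule nn_integral_cong) (auto simp: indicator_def)
  finally show ?thesis .
qed

text \<open>Joint measurability in \<open>(x, t)\<close> is the hypothesis under which Tonelli's
  theorem exchanges the two integrations.\<close>

lemma borel_measurable_indicator_between:
  fixes f g :: "'a \<Rightarrow> real"
  assumes [measurable]: "f \<in> borel_measurable M" "g \<in> borel_measurable M"
  shows "(\<lambda>(x, t). indicator {f x..<g x} t :: ennreal) \<in> borel_measurable (M \<Otimes>\<^sub>M lborel)"
proof -
  have "(\<lambda>p. indicator {p \<in> space (M \<Otimes>\<^sub>M lborel). f (fst p) \<le> snd p \<and> snd p < g (fst p)} p :: ennreal)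
      \<in> borel_measurable (M \<Otimes>\<^sub>M lborel)"
    by measurable
  then show ?thesis
    by (rule measurable_cong[THEN iffD1, rotated]) (auto simp: indicator_def)
qed

lemma (in sigma_finite_measure) borel_measurable_emeasure_between:
  fixes f g :: "'a \<Rightarrow> real"
  assumes "f \<in> borel_measurable M" "g \<in> borel_measurable M"
  shows "(\<lambda>t. emeasure M {x \<in> space M. f x \<le> t \<and> t < g x}) \<in> borel_measurable lborel"
  unfolding emeasure_between_conv_nn_integral[OF assms]
  using measurable_compose[OF measurable_pair_swap' borel_measurable_indicator_between[OF assms]]
  by (intro borel_measurable_nn_integral) (simp add: case_prod_beta)

text \<open>By Tonelli, integrate over \<open>t\<close> first: for fixed \<open>x\<close> this gives
  the length of \<open>{f x..<g x}\<close>. If \<open>g x < f x\<close>, the interval is empty and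
  \<open>ennreal\<close> truncates the negative difference to 0.\<close>

lemma (in sigma_finite_measure) nn_integral_emeasure_between:
  fixes f g :: "'a \<Rightarrow> real"
  assumes "f \<in> borel_measurable M" "g \<in> borel_measurable M"
  shows "(\<integral>\<^sup>+t. emeasure M {x \<in> space M. f x \<le> t \<and> t < g x} \<partial>lborel) = (\<integral>\<^sup>+x. ennreal (g x - f x) \<partial>M)"
proof -
  interpret pair_sigma_finite M lborel ..
  have "(\<integral>\<^sup>+t. emeasure M {x \<in> space M. f x \<le> t \<and> t < g x} \<partial>lborel)
      = (\<integral>\<^sup>+x. (\<integral>\<^sup>+t. indicator {f x..<g x} t \<partial>lborel) \<partial>M)"
    unfolding emeasure_between_conv_nn_integral[OF assms]
    by (rule Fubini') (rule borel_measurable_indicator_between[OF assms])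
  also have "\<dots> = (\<integral>\<^sup>+x. ennreal (g x - f x) \<partial>M)"
  proof (rule nn_integral_cong)
    show "(\<integral>\<^sup>+t. indicator {f x..<g x} t \<partial>lborel) = ennreal (g x - f x)" for x
      by (cases "f x \<le> g x") (auto simp: ennreal_neg)
  qed
  finally show ?thesis .
qed

lemma nn_integral_l1_dist:
  "(\<integral>\<^sup>+z. ennreal \<bar>pmf p z - pmf q z\<bar> \<partial>count_space UNIV) = ennreal (l1_dist p q)"
proof -
  have "(\<lambda>z. \<bar>pmf p z - pmf q z\<bar>) abs_summable_on UNIV"
    using l1_dist_summable[of p q] by (simp add: abs_summable_equivalent[symmetric])
  then show ?thesis
    by (simp add: nn_integral_conv_infsetsum infsetsum_infsum l1_dist_def)
qed

text \<open>Finite balls around one point exhaust the space. Countability serves to exchange the sum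
  over \<open>z\<close> with the integral against \<open>\<mu>\<close>.\<close>

lemma bounded_geometry_countable:
  assumes "bounded_geometry TYPE('a::metric_space)"
  shows "countable (UNIV :: 'a set)"
proof -
  fix x\<^sub>0 :: 'a
  have "finite (cball x\<^sub>0 (real (Suc n)))" for n
    using assms unfolding bounded_geometry_def by (meson of_nat_0_less_iff zero_less_Suc)
  moreover have "(UNIV :: 'a set) = (\<Union>n. cball x\<^sub>0 (real (Suc n)))"
  proof (intro set_eqI iffI)
    fix y
    obtain n where "dist x\<^sub>0 y \<le> real n" using real_arch_simple by blast
    then show "y \<in> (\<Union>n. cball x\<^sub>0 (real (Suc n)))" by (auto intro!: exI[of _ n])
  qed simp
  ultimately show ?thesis
    by (metis countable_UN countable_finite countableI_type)
qed

text \<open>A finite nonempty set attains the infimum defining \<open>infdist\<close>, so a single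
  point witnesses the bound \<open>R\<close>.\<close>

lemma bdry_finite:
  assumes "finite E" "x \<in> bdry R E"
  obtains y where "y \<in> E" "dist x y \<le> R" "x \<notin> E"
proof -
  have E: "E \<noteq> {}" "infdist x E \<le> R" "x \<notin> E"
    using assms(2) by (auto simp: bdry_def nbhd_def)
  have "infdist x E \<in> dist x ` E"
    using E(1) assms(1) by (simp add: infdist_def cInf_eq_Min)
  then show ?thesis using E that by auto
qed

lemma diameter_subset_cball:
  assumes "E \<subseteq> cball z S" "0 \<le> S"
  shows "diameter E \<le> 2 * S"
proof (cases "E = {}")
  case False
  have "dist x y \<le> 2 * S" if "x \<in> E" "y \<in> E" for x y
  proof -
    have "dist z x \<le> S" "dist z y \<le> S" using assms(1) that by auto
    then show ?thesis using dist_triangle3[of x y z] by simp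
  qed
  then show ?thesis
    using False by (auto simp: diameter_def intro!: cSUP_least)
qed (use assms in simp)

theorem proposition3p2:
  assumes "bounded_geometry TYPE('a::metric_space)"
    and "property_A TYPE('a)"
  shows "ULA_mu TYPE('a)"
  unfolding ULA_mu_def
proof (intro allI impI)
  fix R \<epsilon> :: real assume R: "R > 0" and \<epsilon>: "\<epsilon> > 0"
  obtain N :: nat where finite_ball: "finite (cball x R)" and card_ball: "card (cball x R) \<le> N" for x :: 'a
    using assms(1) R unfolding bounded_geometry_def by metis
  \<comment> \<open>The final estimate adds at most \<open>N\<close> distances, each below
    \<open>\<delta>\<close>. The added 1 prevents division by zero and keeps
    \<open>N * \<delta> < \<epsilon>\<close> strict.\<close>
  define \<delta> where "\<delta> = \<epsilon> / (real N + 1)"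
  have \<delta>: "\<delta> > 0" "real N * \<delta> < \<epsilon>" using \<epsilon> by (auto simp: \<delta>_def field_simps)
  obtain S and \<xi> :: "'a \<Rightarrow> 'a pmf" where S: "S > 0"
    and l1: "\<And>x y. dist x y \<le> R \<Longrightarrow> l1_dist (\<xi> x) (\<xi> y) < \<delta>"
    and supp: "\<And>x. set_pmf (\<xi> x) \<subseteq> cball x S"
    using assms(2) R \<delta>(1) unfolding property_A_def by metis
  have countable: "countable (UNIV :: 'a set)"
    by (rule bounded_geometry_countable[OF assms(1)])
  show "\<exists>S>0. \<forall>\<mu> :: 'a pmf. \<exists>E. finite E \<and> diameter E \<le> S \<and>
      measure_pmf.prob \<mu> (bdry R E) < \<epsilon> * measure_pmf.prob \<mu> E"
  proof (rule exI[of _ "2 * S"], rule conjI, rule_tac [2] allI)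
    show "2 * S > 0" using S by simp
    fix \<mu> :: "'a pmf"
    define f where "f z x = pmf (\<xi> x) z" for z x
    \<comment> \<open>A sum rather than a maximum over the ball: it still bounds each single
      difference, and summing it over \<open>z\<close> produces \<open>l1_dist\<close>
      terms.\<close>
    define h where "h z x = (\<Sum>y\<in>cball x R. \<bar>f z y - f z x\<bar>)" for z x
    \<comment> \<open>The guard \<open>0 \<le> t\<close> makes the slices with negative
      \<open>t\<close> empty; otherwise they would be the whole space. Integrals over all real
      \<open>t\<close> thus see only \<open>t \<ge> 0\<close>.\<close>
    define E where "E z t = {x. 0 \<le> t \<and> t < f z x}" for z t
    have E_ball: "E z t \<subseteq> cball z S" for z t
    proof
      fix x assume "x \<in> E z t"
      then have "z \<in> set_pmf (\<xi> x)" by (auto simp: E_def f_def set_pmf_iff)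
      then show "x \<in> cball z S" using supp[of x] by (auto simp: dist_commute)
    qed
    have finite_E: "finite (E z t)" for z t
      using E_ball assms(1) S finite_subset unfolding bounded_geometry_def by metis
    have bdry_E: "bdry R (E z t) \<subseteq> {x. f z x \<le> t \<and> t < f z x + h z x}" for z t
    proof
      fix x assume "x \<in> bdry R (E z t)"
      then obtain y where y: "y \<in> E z t" "dist x y \<le> R" "x \<notin> E z t"
        using bdry_finite[OF finite_E] by blast
      have "\<bar>f z y - f z x\<bar> \<le> h z x"
        unfolding h_def using y(2) finite_ball by (intro member_le_sum) auto
      \<comment> \<open>Membership of \<open>y\<close> gives \<open>0 \<le> t\<close>, so
        \<open>x\<close> can fail to lie in the slice only through
        \<open>f z x \<le> t\<close>.\<close>
      then show "x \<in> {x. f z x \<le> t \<and> t < f z x + h z x}" using y by (auto simp: E_def)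
    qed
    have "\<exists>z t. measure_pmf.prob \<mu> (bdry R (E z t)) < \<epsilon> * measure_pmf.prob \<mu> (E z t)"
    proof (rule ccontr)
      assume "\<not> ?thesis"
      then have le: "\<epsilon> * measure_pmf.prob \<mu> (E z t) \<le> measure_pmf.prob \<mu> (bdry R (E z t))" for z t
        by (auto simp: not_less)
      \<comment> \<open>Integrate the assumed failure \<open>le\<close> over \<open>t\<close> for
        fixed \<open>z\<close>, using the interval formula on both sides: with bounds 0 and
        \<open>f z\<close>, then \<open>f z\<close> and \<open>f z + h z\<close>.\<close>
      have slice: "ennreal \<epsilon> * (\<integral>\<^sup>+x. f z x \<partial>\<mu>) \<le> (\<integral>\<^sup>+x. h z x \<partial>\<mu>)" for z
      proof -
        have "ennreal \<epsilon> * (\<integral>\<^sup>+x. f z x \<partial>\<mu>) = ennreal \<epsilon> * (\<integral>\<^sup>+t. emeasure \<mu> (E z t) \<partial>lborel)"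
          using measure_pmf.nn_integral_emeasure_between[of "\<lambda>_. 0" \<mu> "f z"] by (simp add: E_def)
        also have "\<dots> = (\<integral>\<^sup>+t. ennreal \<epsilon> * emeasure \<mu> (E z t) \<partial>lborel)"
          using measure_pmf.borel_measurable_emeasure_between[of "\<lambda>_. 0" \<mu> "f z"]
          by (intro nn_integral_cmult[symmetric]) (simp add: E_def)
        also have "\<dots> \<le> (\<integral>\<^sup>+t. emeasure \<mu> {x. f z x \<le> t \<and> t < f z x + h z x} \<partial>lborel)"
        proof (rule nn_integral_mono)
          fix t
          have "ennreal \<epsilon> * emeasure \<mu> (E z t) \<le> emeasure \<mu> (bdry R (E z t))"
            using le[of z t] \<epsilon> by (simp add: measure_pmf.emeasure_eq_measure ennreal_mult[symmetric])
          also have "\<dots> \<le> emeasure \<mu> {x. f z x \<le> t \<and> t < f z x + h z x}"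
            using bdry_E by (intro emeasure_mono) auto
          finally show "ennreal \<epsilon> * emeasure \<mu> (E z t) \<le> \<dots>" .
        qed
        also have "\<dots> = (\<integral>\<^sup>+x. h z x \<partial>\<mu>)"
          using measure_pmf.nn_integral_emeasure_between[of "f z" \<mu> "\<lambda>x. f z x + h z x"] by simp
        finally show ?thesis .
      qed
      have "(\<integral>\<^sup>+z. (\<integral>\<^sup>+x. f z x \<partial>\<mu>) \<partial>count_space UNIV) = (\<integral>\<^sup>+x. (\<integral>\<^sup>+z. f z x \<partial>count_space UNIV) \<partial>\<mu>)"
        by (rule nn_integral_count_space_nn_integral[OF countable, symmetric]) simp
      also have "\<dots> = 1"
        by (simp add: f_def nn_integral_pmf measure_pmf.emeasure_space_1[simplified])
      finally have "ennreal \<epsilon> = (\<integral>\<^sup>+z. ennreal \<epsilon> * (\<integral>\<^sup>+x. f z x \<partial>\<mu>) \<partial>count_space UNIV)"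
        by (simp add: nn_integral_cmult)
      also have "\<dots> \<le> (\<integral>\<^sup>+z. (\<integral>\<^sup>+x. h z x \<partial>\<mu>) \<partial>count_space UNIV)"
        by (intro nn_integral_mono slice)
      also have "\<dots> = (\<integral>\<^sup>+x. (\<integral>\<^sup>+z. h z x \<partial>count_space UNIV) \<partial>\<mu>)"
        by (rule nn_integral_count_space_nn_integral[OF countable, symmetric]) simp
      also have "\<dots> \<le> (\<integral>\<^sup>+x. ennreal (real N * \<delta>) \<partial>\<mu>)"
      proof (rule nn_integral_mono)
        fix x
        \<comment> \<open>Exchanging the finite sum over \<open>y\<close> with the sum over
          \<open>z\<close> leaves one \<open>l1_dist\<close> per point of the ball, each controlled
          by property A.\<close>
        have "(\<integral>\<^sup>+z. h z x \<partial>count_space UNIV)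
            = (\<integral>\<^sup>+z. (\<Sum>y\<in>cball x R. ennreal \<bar>f z y - f z x\<bar>) \<partial>count_space UNIV)"
          by (simp add: h_def sum_ennreal)
        also have "\<dots> = (\<Sum>y\<in>cball x R. ennreal (l1_dist (\<xi> y) (\<xi> x)))"
          by (simp add: nn_integral_sum f_def nn_integral_l1_dist del: sum_ennreal)
        also have "\<dots> \<le> (\<Sum>y\<in>cball x R. ennreal \<delta>)"
          by (intro sum_mono ennreal_leI order.strict_implies_order[OF l1]) (simp add: dist_commute)
        also have "\<dots> = ennreal (real (card (cball x R)) * \<delta>)"
          using \<delta>(1) by (simp add: ennreal_mult ennreal_of_nat_eq_real_of_nat)
        also have "\<dots> \<le> ennreal (real N * \<delta>)"
          using \<delta>(1) card_ball by (intro ennreal_leI mult_right_mono) auto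
        finally show "(\<integral>\<^sup>+z. h z x \<partial>count_space UNIV) \<le> ennreal (real N * \<delta>)" .
      qed
      also have "\<dots> = ennreal (real N * \<delta>)" by simp
      finally show False using \<delta> \<epsilon> by (simp add: ennreal_le_iff)
    qed
    then obtain z t where zt: "measure_pmf.prob \<mu> (bdry R (E z t)) < \<epsilon> * measure_pmf.prob \<mu> (E z t)"
      by blast
    have "diameter (E z t) \<le> 2 * S"
      using diameter_subset_cball[OF E_ball] S by simp
    with zt finite_E show "\<exists>E. finite E \<and> diameter E \<le> 2 * S \<and>
        measure_pmf.prob \<mu> (bdry R E) < \<epsilon> * measure_pmf.prob \<mu> E"
      by blast
  qed
qed

end
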